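(* Let $G$ be a finite simple graph without isolated vertices and let $n\ge 2$ be an integer. Then $\gamma_g(G)=\gamma_{Zg}(G\circ K_n)$, where $K_n$ is the complete graph on $n$ vertices and $\circ$ denotes the lexicographic product.
   Context: Graphs are finite and simple. $N(v)$ and $N[v]=N(v)\cup\{v\}$ denote the open and closed neighborhood of a vertex $v$. The lexicographic product $G\circ H$ has vertex set $V(G)\times V(H)$; vertices $(g_1,h_1)$ and $(g_2,h_2)$ are adjacent if $g_1g_2\in E(G)$, or $g_1=g_2$ and $h_1h_2\in E(H)$. Games: two players, Dominator and Staller, alternately select vertices $v_1,v_2,\ldots$ of an isolate-free graph $G$. In the domination game the $i$-th move $v_i$ is legal if $N[v_i]\setminus\bigcup_{j=1}^{i-1}N[v_j]\neq\emptyset$. In the Z-domination game the $i$-th move $v_i$ is legal if $N(v_i)\setminus\bigcup_{j=1}^{i-1}N[v_j]\neq\emptyset$. Each game ends when no legal move is available. Dominator wants to minimize the total number of moves, Staller wants to maximize it. When Dominator moves first and both players play optimally, the total number of moves played (by both players) is $\gamma_g(G)$ for the domination game and $\gamma_{Zg}(G)$ for the Z-domination game. *)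

theory Defs
  imports "Graph_Theory.Kuratowski"
begin

text \<open>
  Finite simple graphs are represented by \<^locale>\<open>pair_graph\<close>: a finite vertex set with a finite,
  symmetric, irreflexive set of arcs, each edge being the pair of its two opposite arcs.
\<close>

definition open_nbhd :: "'a pair_pre_digraph \<Rightarrow> 'a \<Rightarrow> 'a set" where
  "open_nbhd G v = {w. (v, w) \<in> parcs G}"

definition closed_nbhd :: "'a pair_pre_digraph \<Rightarrow> 'a \<Rightarrow> 'a set" where
  "closed_nbhd G v = insert v (open_nbhd G v)"

definition isolate_free :: "'a pair_pre_digraph \<Rightarrow> bool" where
  "isolate_free G \<longleftrightarrow> (\<forall>v \<in> pverts G. open_nbhd G v \<noteq> {})"

definition lexicographic_product ::
  "'a pair_pre_digraph \<Rightarrow> 'b pair_pre_digraph \<Rightarrow> ('a \<times> 'b) pair_pre_digraph" where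
  "lexicographic_product G H =
     \<lparr> pverts = pverts G \<times> pverts H,
       parcs = {((g1, h1), (g2, h2)) | g1 h1 g2 h2.
         g1 \<in> pverts G \<and> g2 \<in> pverts G \<and> h1 \<in> pverts H \<and> h2 \<in> pverts H \<and>
         ((g1, g2) \<in> parcs G \<or> g1 = g2 \<and> (h1, h2) \<in> parcs H)} \<rparr>"

datatype game = Dom_game | Z_game

fun game_nbhd :: "game \<Rightarrow> 'a pair_pre_digraph \<Rightarrow> 'a \<Rightarrow> 'a set" where
  "game_nbhd Dom_game = closed_nbhd"
| "game_nbhd Z_game = open_nbhd"

text \<open>
  The list \<open>ms\<close> is the sequence of moves played so far. In both games the vertices already
  dominated form the union of the closed neighborhoods.
\<close>

definition legal_moves :: "game \<Rightarrow> 'a pair_pre_digraph \<Rightarrow> 'a list \<Rightarrow> 'a set" where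
  "legal_moves r G ms =
     {v \<in> pverts G. game_nbhd r G v - (\<Union>u \<in> set ms. closed_nbhd G u) \<noteq> {}}"

lemma game_nbhd_subset_closed: "game_nbhd r G v \<subseteq> closed_nbhd G v"
  by (cases r) (auto simp: closed_nbhd_def)

lemma closed_nbhd_subset:
  assumes "pair_graph G" "v \<in> pverts G"
  shows "closed_nbhd G v \<subseteq> pverts G"
proof -
  interpret pair_graph G by fact
  show ?thesis using assms(2) by (auto simp: closed_nbhd_def open_nbhd_def dest: in_arcsD2)
qed

lemma legal_move_decreases:
  assumes "pair_graph G" "v \<in> legal_moves r G ms"
  shows "card (pverts G - (\<Union>u \<in> set (ms @ [v]). closed_nbhd G u))
       < card (pverts G - (\<Union>u \<in> set ms. closed_nbhd G u))"
proof -
  interpret pair_graph G by fact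
  from assms(2) have v: "v \<in> pverts G" by (simp add: legal_moves_def)
  from assms(2) obtain w where "w \<in> game_nbhd r G v" "w \<notin> (\<Union>u \<in> set ms. closed_nbhd G u)"
    by (auto simp: legal_moves_def)
  moreover have "w \<in> closed_nbhd G v" "w \<in> pverts G"
    using game_nbhd_subset_closed[of r G v] closed_nbhd_subset[OF assms(1) v] calculation
    by blast+
  ultimately show ?thesis
    by (intro psubset_card_mono) (auto simp: pair_finite_verts)
qed

text \<open>
  The number of moves still to be played after \<open>ms\<close> under optimal play, by backward induction.
  Dominator makes the first move, so it is Dominator's turn exactly if \<open>ms\<close> has even length.
  The guard \<open>pair_graph G\<close> only serves to make the recursion terminate.
\<close>

function remaining_moves :: "game \<Rightarrow> 'a pair_pre_digraph \<Rightarrow> 'a list \<Rightarrow> nat" where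
  "remaining_moves r G ms =
     (if \<not> pair_graph G \<or> legal_moves r G ms = {} then 0
      else Suc ((if even (length ms) then Min else Max)
                  ((\<lambda>v. remaining_moves r G (ms @ [v])) ` legal_moves r G ms)))"
  by pat_completeness auto
termination
  by (relation "measure (\<lambda>(r, G, ms). card (pverts G - (\<Union>u \<in> set ms. closed_nbhd G u)))")
     (auto dest: legal_move_decreases)

declare remaining_moves.simps [simp del]

definition game_domination_number :: "'a pair_pre_digraph \<Rightarrow> nat" (\<open>\<gamma>\<^sub>g\<close>) where
  "\<gamma>\<^sub>g G = remaining_moves Dom_game G []"

definition Z_game_domination_number :: "'a pair_pre_digraph \<Rightarrow> nat" (\<open>\<gamma>\<^sub>Z\<^sub>g\<close>) where
  "\<gamma>\<^sub>Z\<^sub>g G = remaining_moves Z_game G []"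

lemma pair_graph_lexicographic_product:
  assumes "pair_graph G" "pair_graph H"
  shows "pair_graph (lexicographic_product G H)"
proof -
  interpret G: pair_graph G by fact
  interpret H: pair_graph H by fact
  have fin: "finite (pverts G \<times> pverts H)"
    by (simp add: G.pair_finite_verts H.pair_finite_verts)
  have symG: "(x, y) \<in> parcs G \<Longrightarrow> (y, x) \<in> parcs G" for x y
    using G.pair_sym_arcs by (auto simp: symmetric_def elim: symE)
  have symH: "(x, y) \<in> parcs H \<Longrightarrow> (y, x) \<in> parcs H" for x y
    using H.pair_sym_arcs by (auto simp: symmetric_def elim: symE)
  show ?thesis
  proof unfold_locales
    show "finite (parcs (lexicographic_product G H))"
      by (rule finite_subset[OF _ finite_cartesian_product[OF fin fin]])
         (auto simp: lexicographic_product_def)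
    show "symmetric (with_proj (lexicographic_product G H))"
      using symG symH by (auto simp: symmetric_def lexicographic_product_def intro!: symI)
  qed (use fin G.pair_no_loops H.pair_no_loops in \<open>fastforce simp: lexicographic_product_def\<close>)+
qed

end

theory Submission
  imports Defs
begin

text \<open>
  In \<open>G \<circ> K\<^sub>n\<close> the closed neighborhood of \<open>(g, h)\<close> is the full cylinder \<open>N[g] \<times> V(K\<^sub>n)\<close>, so the
  undominated set is always a cylinder. As \<open>n \<ge> 2\<close>, removing the single vertex \<open>(g, h)\<close> from the
  closed neighborhood cannot exhaust a fibre, and \<open>(g, h)\<close> is a legal Z-domination move exactly if
  \<open>g\<close> is a legal domination move. Projecting to \<open>G\<close> thus identifies the two game trees, up to
  multiplicities that do not affect minima and maxima.
\<close>

lemma closed_nbhd_lexicographic_product_complete: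
  assumes "pair_graph G" "complete_digraph n (with_proj K)" "g \<in> pverts G" "h \<in> pverts K"
  shows "closed_nbhd (lexicographic_product G K) (g, h) = closed_nbhd G g \<times> pverts K"
proof -
  interpret pair_graph G by fact
  show ?thesis
    using assms(2-4)
    by (auto simp: complete_digraph_pair_def closed_nbhd_def open_nbhd_def lexicographic_product_def
        dest: in_arcsD2)
qed

lemma open_nbhd_lexicographic_product_complete:
  assumes "pair_graph G" "complete_digraph n (with_proj K)" "g \<in> pverts G" "h \<in> pverts K"
  shows "open_nbhd (lexicographic_product G K) (g, h) = closed_nbhd G g \<times> pverts K - {(g, h)}"
proof -
  interpret pair_graph G by fact
  show ?thesis
    \<comment> \<open>A loop at \<open>g\<close> would make \<open>(g, h)\<close> adjacent to
      itself; its absence is what removes exactly this point from the cylinder.\<close>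
    using assms(2-4) pair_no_loops[of "(g, g)"]
    by (auto simp: complete_digraph_pair_def closed_nbhd_def open_nbhd_def lexicographic_product_def
        dest: in_arcsD2)
qed

lemma legal_moves_lexicographic_product_complete:
  assumes G: "pair_graph G" and K: "complete_digraph n (with_proj K)" and "n \<ge> 2"
    and ms: "set ms \<subseteq> pverts G \<times> pverts K"
  shows "legal_moves Z_game (lexicographic_product G K) ms =
    legal_moves Dom_game G (map fst ms) \<times> pverts K"
proof -
  let ?P = "lexicographic_product G K"
  let ?D = "\<Union>u \<in> set (map fst ms). closed_nbhd G u"
  have "card (pverts K) = n"
    using K by (simp add: complete_digraph_pair_def)
  have other: "\<exists>h' \<in> pverts K. h' \<noteq> h" for h
  proof (rule ccontr)
    assume "\<not> ?thesis"
    then have "pverts K \<subseteq> {h}" by blast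
    then have "card (pverts K) \<le> 1" using card_mono[of "{h}"] by fastforce
    then show False using \<open>card (pverts K) = n\<close> \<open>n \<ge> 2\<close> by simp
  qed
  have "(\<Union>u \<in> set ms. closed_nbhd ?P u) = (\<Union>u \<in> set ms. closed_nbhd G (fst u) \<times> pverts K)"
    using ms closed_nbhd_lexicographic_product_complete[OF G K] by (intro SUP_cong) auto
  then have D: "(\<Union>u \<in> set ms. closed_nbhd ?P u) = ?D \<times> pverts K"
    by auto
  \<comment> \<open>For the direction from right to left, let \<open>x\<close> be newly dominated by
    \<open>g\<close>. If \<open>x \<noteq> g\<close>, then \<open>(x, h)\<close> is a witness; if
    \<open>x = g\<close>, the second vertex \<open>h'\<close> from \<open>other\<close> gives the
    witness \<open>(g, h')\<close>.\<close>
  have "open_nbhd ?P (g, h) - ?D \<times> pverts K \<noteq> {} \<longleftrightarrow> closed_nbhd G g - ?D \<noteq> {}"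
    if "g \<in> pverts G" "h \<in> pverts K" for g h
    unfolding open_nbhd_lexicographic_product_complete[OF G K that] using other[of h] by blast
  then have "v \<in> legal_moves Z_game ?P ms \<longleftrightarrow> v \<in> legal_moves Dom_game G (map fst ms) \<times> pverts K"
    for v
    unfolding legal_moves_def D
    by (cases v) (auto simp: lexicographic_product_def)
  then show ?thesis by blast
qed

text \<open>Induction on the number of undominated vertices of \<open>G\<close>: a legal move in the
  product projects to a legal move in \<open>G\<close>, so this number drops.\<close>

lemma remaining_moves_lexicographic_product_complete:
  assumes G: "pair_graph G" and K: "complete_digraph n (with_proj K)" and n: "n \<ge> 2"
    and ms: "set ms \<subseteq> pverts G \<times> pverts K"
  shows "remaining_moves Z_game (lexicographic_product G K) ms =
    remaining_moves Dom_game G (map fst ms)"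
  using ms
proof (induction "card (pverts G - (\<Union>u \<in> set (map fst ms). closed_nbhd G u))"
    arbitrary: ms rule: less_induct)
  case less
  let ?P = "lexicographic_product G K"
  let ?L = "legal_moves Dom_game G (map fst ms)"
  have legal: "legal_moves Z_game ?P ms = ?L \<times> pverts K"
    by (rule legal_moves_lexicographic_product_complete[OF G K n less.prems])
  have "pverts K \<noteq> {}"
    using K n by (auto simp: complete_digraph_pair_def)
  have "remaining_moves Z_game ?P (ms @ [v]) = remaining_moves Dom_game G (map fst ms @ [fst v])"
    if "v \<in> ?L \<times> pverts K" for v
  proof -
    have "fst v \<in> ?L" "set (ms @ [v]) \<subseteq> pverts G \<times> pverts K"
      using that less.prems by (auto simp: legal_moves_def)
    then show ?thesis
      using less.hyps[of "ms @ [v]"] legal_move_decreases[OF G, of "fst v" Dom_game "map fst ms"]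
      by simp
  qed
  \<comment> \<open>The value after a move depends only on its first coordinate, so both games offer
    the same set of values.\<close>
  then have "(\<lambda>v. remaining_moves Z_game ?P (ms @ [v])) ` (?L \<times> pverts K)
      = (\<lambda>g. remaining_moves Dom_game G (map fst ms @ [g])) ` fst ` (?L \<times> pverts K)"
    unfolding image_image by (intro image_cong) auto
  also have "fst ` (?L \<times> pverts K) = ?L"
    using \<open>pverts K \<noteq> {}\<close> by simp
  finally show ?case
    \<comment> \<open>As \<open>map fst\<close> preserves length, the same player is to move on both
      sides; as \<open>pverts K\<close> is nonempty, both games end at the same time.\<close>
    using \<open>pverts K \<noteq> {}\<close> G legal
      pair_graph_lexicographic_product[OF G pair_graphI_complete[OF K]]
    by (simp add: remaining_moves.simps[of Z_game ?P ms]
        remaining_moves.simps[of Dom_game G "map fst ms"])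
qed

theorem proposition3p2:
  fixes G :: "'a pair_pre_digraph" and K :: "'b pair_pre_digraph" and n :: nat
  assumes "pair_graph G" and "isolate_free G"
    and "n \<ge> 2" and "complete_digraph n (with_proj K)"
  shows "\<gamma>\<^sub>g G = \<gamma>\<^sub>Z\<^sub>g (lexicographic_product G K)"
  using remaining_moves_lexicographic_product_complete[OF assms(1,4,3), of "[]"]
  by (simp add: game_domination_number_def Z_game_domination_number_def)

end
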